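(* Let $P=\langle A,S,s_0,T\rangle$ be a well-behaved GSP process such that all transitions are internal transitions or negotiations. Then for every $s\in S$, reachability of $s$ is synchronization-independent in $P$; that is, for every $s\in S$ and every $m\in\mathbb{N}$, $c=m$ is a cutoff for $\phi_m(s)$: $$\bigl(\exists n\in\mathbb{N}:\ \mathcal{M}(n)\models\phi_m(s)\bigr)\iff\mathcal{M}(m)\models\phi_m(s).$$
   Context: **Guarded process.** A (guarded) GSP process is $P=\langle A,S,s_0,T\rangle$ with $S$ a finite set of local states, $s_0\in S$ initial, $T\subseteq S\times A\times\mathcal{P}(S)\times S$; the subset of $S$ labelling a transition is its guard. $A$ is built from a finite set $\mathcal{A}$ of global actions; in general each has an arity $k\ge1$ and is a $k$-sender or a $k$-maximal action, but only $1$-sender actions occur in this statement. A $1$-sender action $a$ contributes a sending action $a!!$ with exactly one transition $s_a\xrightarrow{a!!,G_a}s_a'$, and a receiving action $a??$ such that each $s\in S$ has exactly one transition $s\xrightarrow{a??,G_a}M_a(s)$; all local transitions based on $a$ have the same guard $G_a$. $\mathcal{G}$ is the set of all guards occurring on transitions of $P$. A transition is unguarded if its guard is $S$. **Internal transitions and negotiations.** An internal action is a $1$-sender action with $M_a(s)=s$ for all $s$; its sending transition is an internal transition. A negotiation is a synchronous transition of all processes with no distinguished sender; it is modelled as a set of $1$-sender actions, with common receiving transitions and a common guard, in which every local receiving transition $s\xrightarrow{a??}s'$ is paired with a sending transition $s\xrightarrow{a!!}s'$, so that an arbitrary process may act as the sender. **Systems.** Global states are $\mathbf{q}\in\mathbb{N}^S$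 counting processes in each local state; $\mathrm{supp}(\mathbf{q})=\{s:\mathbf{q}(s)>0\}$. A $1$-sender action $a$ is enabled in $\mathbf{q}$ iff $\mathrm{supp}(\mathbf{q})\subseteq G_a$ and $\mathbf{q}(s_a)\ge1$; then one process moves from $s_a$ to $s'_a$ and every other process moves from its state $s$ to $M_a(s)$. $\mathcal{M}(n)$ is the system with initial global state having $n$ processes in $s_0$ and none elsewhere. $\mathcal{M}(n)\models\phi_m(s)$ means some global state $\mathbf{q}$ with $\mathbf{q}(s)\ge m$ is reachable in $\mathcal{M}(n)$. **Well-behavedness.** For $t,s\in S$: $t\triangleleft s$ means $\forall G\in\mathcal{G}\,(s\in G\Rightarrow t\in G)$. $s\rightsquigarrow s'$ means there is a path of unguarded internal transitions from $s$ to $s'$; for $G\subseteq S$, $s\rightsquigarrow_G s'$ means there is a path of internal transitions from $s$ to $s'$ such that each transition is guarded by some $G'\supseteq G$. A $1$-sender action $a$ with guard $G$ is (weakly) guard-compatible if for all $G'\in\mathcal{G}$: $s'_a\in G'\Rightarrow\forall s\in G:\bigl(M_a(s)\in G'\vee\exists r\in S:(r\triangleleft s'_a\wedge M_a(s)\rightsquigarrow r)\bigr)$. For an internal action it suffices instead that for all $G'\in\mathcal{G}$ and $t\in G$: $(s_a\notin G'\wedge s_a'\in G')\Rightarrow\exists t'\in S:(t'\triangleleft s_a'\wedge t\rightsquigarrow_{G''}t')$ with $G''=G\cup\{r\in S: r\triangleleft s_a'\}$. $P$ is well-behaved if every action is (weakly) guard-compatible. *)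

theory Defs
  imports Main "HOL-Library.Multiset"
begin

datatype 'a local_action = Send 'a | Recv 'a

text \<open>
  Processes are given by their global actions (all of them 1-sender actions), local states,
  initial state and local transitions. The set of local actions is
  \<open>Send ` acts P \<union> Recv ` acts P\<close>; \<open>Send a\<close> is a!! and \<open>Recv a\<close> is a??.
\<close>

record ('s, 'a) process =
  acts :: "'a set"
  states :: "'s set"
  start :: 's
  transitions :: "('s \<times> 'a local_action \<times> 's set \<times> 's) set"

definition gsp_process :: "('s, 'a) process \<Rightarrow> bool" where
  "gsp_process P \<longleftrightarrow>
     finite (acts P) \<and> finite (states P) \<and> start P \<in> states P \<and>
     transitions P \<subseteq>
       states P \<times> (Send ` acts P \<union> Recv ` acts P) \<times> Pow (states P) \<times> states P \<and>
     (\<forall>a\<in>acts P.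
        (\<exists>!\<tau>. \<tau> \<in> transitions P \<and> (\<exists>s G s'. \<tau> = (s, Send a, G, s'))) \<and>
        (\<forall>s\<in>states P. \<exists>!\<tau>. \<tau> \<in> transitions P \<and> (\<exists>G s'. \<tau> = (s, Recv a, G, s'))) \<and>
        (\<exists>G. \<forall>s l H s'. (s, l, H, s') \<in> transitions P \<longrightarrow> l \<in> {Send a, Recv a} \<longrightarrow> H = G))"

text \<open>
  The components $s_a$, $s'_a$, $M_a$ and $G_a$ of an action. They are determined uniquely for
  actions of a \<open>gsp_process\<close> (for $M_a$, on its local states).
\<close>

definition src :: "('s, 'a) process \<Rightarrow> 'a \<Rightarrow> 's" where
  "src P a = (THE s. \<exists>G s'. (s, Send a, G, s') \<in> transitions P)"

definition dst :: "('s, 'a) process \<Rightarrow> 'a \<Rightarrow> 's" where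
  "dst P a = (THE s'. \<exists>s G. (s, Send a, G, s') \<in> transitions P)"

definition recv :: "('s, 'a) process \<Rightarrow> 'a \<Rightarrow> 's \<Rightarrow> 's" where
  "recv P a s = (THE s'. \<exists>G. (s, Recv a, G, s') \<in> transitions P)"

definition guard :: "('s, 'a) process \<Rightarrow> 'a \<Rightarrow> 's set" where
  "guard P a = (THE G. \<exists>s s'. (s, Send a, G, s') \<in> transitions P)"

definition guards :: "('s, 'a) process \<Rightarrow> 's set set" where
  "guards P = {G. \<exists>s l s'. (s, l, G, s') \<in> transitions P}"

definition internal_action :: "('s, 'a) process \<Rightarrow> 'a \<Rightarrow> bool" where
  "internal_action P a \<longleftrightarrow> a \<in> acts P \<and> (\<forall>s\<in>states P. recv P a s = s)"

definition internal_transition :: "('s, 'a) process \<Rightarrow> 's \<Rightarrow> 's set \<Rightarrow> 's \<Rightarrow> bool" where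
  "internal_transition P s G s' \<longleftrightarrow>
     (\<exists>a. internal_action P a \<and> (s, Send a, G, s') \<in> transitions P)"

text \<open>
  The last two conjuncts pair receiving with sending transitions in both directions: every local
  receiving transition has a sending counterpart in \<open>N\<close>, and no sender in \<open>N\<close> moves differently
  from a receiver in the same local state.
\<close>

definition negotiation :: "('s, 'a) process \<Rightarrow> 'a set \<Rightarrow> bool" where
  "negotiation P N \<longleftrightarrow>
     N \<subseteq> acts P \<and>
     (\<forall>a\<in>N. \<forall>b\<in>N. guard P a = guard P b) \<and>
     (\<forall>a\<in>N. \<forall>b\<in>N. \<forall>s\<in>states P. recv P a s = recv P b s) \<and>
     (\<forall>s\<in>states P. \<exists>a\<in>N. src P a = s \<and> dst P a = recv P a s) \<and>
     (\<forall>a\<in>N. dst P a = recv P a (src P a))"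

definition internal_or_negotiation :: "('s, 'a) process \<Rightarrow> bool" where
  "internal_or_negotiation P \<longleftrightarrow>
     (\<forall>a\<in>acts P. internal_action P a \<or> (\<exists>N. negotiation P N \<and> a \<in> N))"

text \<open>
  Global states, i.e. elements of $\mathbb{N}^S$, are multisets over the local states, with
  \<open>count q s\<close> for $\mathbf{q}(s)$ and \<open>set_mset q\<close> for the support.
\<close>

definition enabled :: "('s, 'a) process \<Rightarrow> 'a \<Rightarrow> 's multiset \<Rightarrow> bool" where
  "enabled P a q \<longleftrightarrow> set_mset q \<subseteq> guard P a \<and> count q (src P a) \<ge> 1"

definition fire :: "('s, 'a) process \<Rightarrow> 'a \<Rightarrow> 's multiset \<Rightarrow> 's multiset" where
  "fire P a q = {#dst P a#} + image_mset (recv P a) (q - {#src P a#})"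

definition step :: "('s, 'a) process \<Rightarrow> 's multiset \<Rightarrow> 's multiset \<Rightarrow> bool" where
  "step P q q' \<longleftrightarrow> (\<exists>a\<in>acts P. enabled P a q \<and> q' = fire P a q)"

definition reachable :: "('s, 'a) process \<Rightarrow> nat \<Rightarrow> 's multiset \<Rightarrow> bool" where
  "reachable P n q \<longleftrightarrow> (step P)\<^sup>*\<^sup>* (replicate_mset n (start P)) q"

text \<open>\<open>sat_phi P n m s\<close> is $\mathcal{M}(n) \models \phi_m(s)$.\<close>

definition sat_phi :: "('s, 'a) process \<Rightarrow> nat \<Rightarrow> nat \<Rightarrow> 's \<Rightarrow> bool" where
  "sat_phi P n m s \<longleftrightarrow> (\<exists>q. reachable P n q \<and> count q s \<ge> m)"

definition cutoff :: "('s, 'a) process \<Rightarrow> nat \<Rightarrow> nat \<Rightarrow> 's \<Rightarrow> bool" where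
  "cutoff P c m s \<longleftrightarrow> ((\<exists>n. sat_phi P n m s) \<longleftrightarrow> sat_phi P c m s)"

definition synchronization_independent :: "('s, 'a) process \<Rightarrow> 's \<Rightarrow> bool" where
  "synchronization_independent P s \<longleftrightarrow> (\<forall>m. cutoff P m m s)"

text \<open>\<open>guard_below P t s\<close> is $t \triangleleft s$.\<close>

definition guard_below :: "('s, 'a) process \<Rightarrow> 's \<Rightarrow> 's \<Rightarrow> bool" where
  "guard_below P t s \<longleftrightarrow> (\<forall>G\<in>guards P. s \<in> G \<longrightarrow> t \<in> G)"

text \<open>
  The relations $\leadsto$ and $\leadsto_G$. Paths may be empty, so both are reflexive.
\<close>

definition unguarded_path :: "('s, 'a) process \<Rightarrow> 's \<Rightarrow> 's \<Rightarrow> bool" where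
  "unguarded_path P = (\<lambda>s s'. internal_transition P s (states P) s')\<^sup>*\<^sup>*"

definition guarded_path :: "('s, 'a) process \<Rightarrow> 's set \<Rightarrow> 's \<Rightarrow> 's \<Rightarrow> bool" where
  "guarded_path P G = (\<lambda>s s'. \<exists>G'. G \<subseteq> G' \<and> internal_transition P s G' s')\<^sup>*\<^sup>*"

definition weakly_guard_compatible :: "('s, 'a) process \<Rightarrow> 'a \<Rightarrow> bool" where
  "weakly_guard_compatible P a \<longleftrightarrow>
     (\<forall>G'\<in>guards P. dst P a \<in> G' \<longrightarrow>
        (\<forall>s\<in>guard P a.
           recv P a s \<in> G' \<or>
           (\<exists>r\<in>states P. guard_below P r (dst P a) \<and> unguarded_path P (recv P a s) r)))"

definition internal_guard_compatible :: "('s, 'a) process \<Rightarrow> 'a \<Rightarrow> bool" where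
  "internal_guard_compatible P a \<longleftrightarrow>
     (\<forall>G'\<in>guards P. \<forall>t\<in>guard P a. src P a \<notin> G' \<and> dst P a \<in> G' \<longrightarrow>
        (\<exists>t'\<in>states P. guard_below P t' (dst P a) \<and>
           guarded_path P (guard P a \<union> {r \<in> states P. guard_below P r (dst P a)}) t t'))"

definition well_behaved :: "('s, 'a) process \<Rightarrow> bool" where
  "well_behaved P \<longleftrightarrow>
     (\<forall>a\<in>acts P. weakly_guard_compatible P a \<or>
        (internal_action P a \<and> internal_guard_compatible P a))"

end

theory Submission
  imports Defs
begin

text \<open>
  Pick \<open>m\<close> of the processes that end in \<open>s\<close> and forget the others. Guards bound the support from
  above, so they still hold for the chosen processes alone; an internal transition is either made
  by a chosen process or can be skipped; and in a negotiation all processes move by the same map,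
  so any chosen process can act as the sender.
\<close>

text \<open>\<open>internal_action\<close> and \<open>negotiation\<close> constrain
  \<open>recv P a\<close> only on \<open>states P\<close>. This inclusion places the support of
  every global state enabling \<open>a\<close> inside \<open>states P\<close>, so that those
  conditions apply.\<close>

lemma guard_subset_states:
  assumes "gsp_process P" and "a \<in> acts P"
  shows "guard P a \<subseteq> states P"
proof -
  have "\<exists>!\<tau>. \<tau> \<in> transitions P \<and> (\<exists>s G s'. \<tau> = (s, Send a, G, s'))"
    using assms unfolding gsp_process_def by (elim conjE) (drule (1) bspec, elim conjE)
  then obtain \<tau> where \<tau>: "\<tau> \<in> transitions P" "\<exists>s G s'. \<tau> = (s, Send a, G, s')"
    and uniq: "\<And>\<sigma>. \<sigma> \<in> transitions P \<and> (\<exists>s G s'. \<sigma> = (s, Send a, G, s')) \<Longrightarrow> \<sigma> = \<tau>"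
    by (elim ex1E) iprover
  from \<tau>(2) obtain s G s' where eq: "\<tau> = (s, Send a, G, s')" by iprover
  have "guard P a = G"
    unfolding guard_def
  proof (rule the_equality)
    show "\<exists>s s'. (s, Send a, G, s') \<in> transitions P"
      using \<tau>(1) eq by auto
  next
    fix H assume "\<exists>u u'. (u, Send a, H, u') \<in> transitions P"
    then obtain u u' where "(u, Send a, H, u') \<in> transitions P" by iprover
    then show "H = G" using uniq[of "(u, Send a, H, u')"] eq by simp
  qed
  moreover have "transitions P \<subseteq>
      states P \<times> (Send ` acts P \<union> Recv ` acts P) \<times> Pow (states P) \<times> states P"
    using assms(1) unfolding gsp_process_def by (elim conjE)
  then have "G \<subseteq> states P"
    using \<tau>(1) eq by auto
  ultimately show ?thesis by simp
qed

text \<open>Splitting an image splits its source as well; this recovers the earlier local states of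
  chosen processes.\<close>

lemma subseteq_image_mset_obtain:
  assumes "B \<subseteq># image_mset f A"
  obtains C where "C \<subseteq># A" and "B = image_mset f C"
proof -
  obtain D where "image_mset f A = B + D"
    using assms by (auto simp: subset_mset.le_iff_add)
  then obtain C E where "A = C + E" and "B = image_mset f C"
    using image_mset_eq_plusD by blast
  then show thesis
    by (intro that[of C]) simp_all
qed

lemma fire_internal:
  assumes "gsp_process P" and "internal_action P a" and "enabled P a q"
  shows "fire P a q = add_mset (dst P a) (q - {#src P a#})"
proof -
  have "a \<in> acts P" and id: "\<And>x. x \<in> states P \<Longrightarrow> recv P a x = x"
    using assms(2) by (simp_all add: internal_action_def)
  moreover have "set_mset q \<subseteq> guard P a"
    using assms(3) by (simp add: enabled_def)
  ultimately have "set_mset q \<subseteq> states P"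
    using guard_subset_states[OF assms(1)] by blast
  then have "\<And>x. x \<in># q - {#src P a#} \<Longrightarrow> recv P a x = id x"
    using id by (auto dest: in_diffD)
  then have "image_mset (recv P a) (q - {#src P a#}) = image_mset id (q - {#src P a#})"
    by (rule image_mset_cong)
  then show ?thesis
    by (simp add: fire_def)
qed

text \<open>The last conjunct of \<open>negotiation\<close> makes the sender move as a receiver in
  its state would, so the step no longer depends on who sends.\<close>

lemma fire_negotiation:
  assumes "negotiation P N" and "a \<in> N" and "enabled P a q"
  shows "fire P a q = image_mset (recv P a) q"
proof -
  have "src P a \<in># q"
    using assms(3) by (simp add: enabled_def)
  then have "q = add_mset (src P a) (q - {#src P a#})"
    by simp
  then have "image_mset (recv P a) q =
      add_mset (recv P a (src P a)) (image_mset (recv P a) (q - {#src P a#}))"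
    using image_mset_add_mset by metis
  moreover have "dst P a = recv P a (src P a)"
    using assms(1,2) by (simp add: negotiation_def)
  ultimately show ?thesis
    by (simp add: fire_def)
qed

text \<open>The choice is made after the step and traced back. The closure allows zero steps, for
  the case that the sender was not chosen.\<close>

lemma internal_step_restrict:
  assumes "gsp_process P" and "internal_action P a" and "enabled P a q"
    and "r' \<subseteq># fire P a q"
  shows "\<exists>r. r \<subseteq># q \<and> size r = size r' \<and> (step P)\<^sup>*\<^sup>* r r'"
proof -
  let ?rest = "q - {#src P a#}"
  have sub: "r' \<subseteq># add_mset (dst P a) ?rest"
    using assms(4) unfolding fire_internal[OF assms(1-3)] .
  have q: "q = add_mset (src P a) ?rest"
    using assms(3) by (simp add: enabled_def)
  show ?thesis
  \<comment> \<open>Processes are anonymous: if \<open>r'\<close> has a copy of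
    \<open>dst P a\<close>, one copy may be taken to be the sender; otherwise \<open>r'\<close>
    consists of bystanders, which did not move.\<close>
  proof (cases "dst P a \<in># r'")
    case True
    then obtain u where u: "r' = add_mset (dst P a) u"
      by (metis insert_DiffM)
    with sub have "u \<subseteq># ?rest" by simp
    then have r: "add_mset (src P a) u \<subseteq># q"
      using q by (metis mset_subset_eq_add_mset_cancel)
    then have en: "enabled P a (add_mset (src P a) u)"
      using assms(3) set_mset_mono[OF r] by (auto simp: enabled_def)
    have "fire P a (add_mset (src P a) u) = r'"
      using fire_internal[OF assms(1,2) en] u by simp
    then have "step P (add_mset (src P a) u) r'"
      using en assms(2) unfolding step_def internal_action_def by blast
    with r u show ?thesis
      by (intro exI[of _ "add_mset (src P a) u"]) auto
  next
    case False
    then have "r' \<subseteq># ?rest"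
      using sub False by (simp flip: Diff_eq_empty_iff_mset)
    then have "r' \<subseteq># q"
      by (meson diff_subset_eq_self subset_mset.order_trans)
    then show ?thesis by blast
  qed
qed

lemma negotiation_step_restrict:
  assumes "gsp_process P" and "negotiation P N" and "a \<in> N" and "enabled P a q"
    and "r' \<subseteq># fire P a q"
  shows "\<exists>r. r \<subseteq># q \<and> size r = size r' \<and> (step P)\<^sup>*\<^sup>* r r'"
proof -
  obtain r where r: "r \<subseteq># q" and r': "r' = image_mset (recv P a) r"
    using assms(5) unfolding fire_negotiation[OF assms(2-4)] by (rule subseteq_image_mset_obtain)
  have "(step P)\<^sup>*\<^sup>* r r'"
  \<comment> \<open>An empty selection has no process to send, so it takes zero steps.\<close>
  proof (cases "r = {#}")
    case True
    then show ?thesis using r' by simp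
  next
    case False
    then obtain t where t: "t \<in># r" by blast
    have a: "a \<in> acts P"
      using assms(2,3) by (auto simp: negotiation_def)
    have supp: "set_mset r \<subseteq> guard P a"
      using assms(4) set_mset_mono[OF r] by (auto simp: enabled_def)
    then have states: "set_mset r \<subseteq> states P"
      using guard_subset_states[OF assms(1) a] by blast
    \<comment> \<open>The sender of \<open>a\<close> may lie outside \<open>r\<close>;
      \<open>N\<close> has an action sent from every local state, in particular from
      \<open>t\<close>.\<close>
    then obtain b where b: "b \<in> N" "src P b = t"
      using assms(2) t unfolding negotiation_def by blast
    have "guard P b = guard P a"
      using assms(2,3) b unfolding negotiation_def by blast
    then have en: "enabled P b r"
      using supp t b by (simp add: enabled_def)
    have "\<And>x. x \<in># r \<Longrightarrow> recv P b x = recv P a x"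
      using assms(2,3) b states unfolding negotiation_def by blast
    then have "fire P b r = r'"
      using fire_negotiation[OF assms(2) b(1) en] r' by (simp cong: image_mset_cong)
    moreover have "b \<in> acts P"
      using assms(2) b by (auto simp: negotiation_def)
    ultimately show ?thesis
      using en unfolding step_def by blast
  qed
  then show ?thesis
    using r r' by auto
qed

text \<open>Induction on the run, peeling off its last step. The selection \<open>q'\<close> must be
  arbitrary, because the induction hypothesis is applied to the traced-back selection
  \<open>y'\<close>.\<close>

lemma steps_restrict:
  assumes "gsp_process P" and "internal_or_negotiation P"
    and "(step P)\<^sup>*\<^sup>* p q" and "q' \<subseteq># q"
  shows "\<exists>p'. p' \<subseteq># p \<and> size p' = size q' \<and> (step P)\<^sup>*\<^sup>* p' q'"
  using assms(3,4)
proof (induction arbitrary: q' rule: rtranclp_induct)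
  case base
  then show ?case by blast
next
  case (step y z)
  then obtain a where a: "a \<in> acts P" "enabled P a y" "z = fire P a y"
    unfolding step_def by blast
  have q': "q' \<subseteq># fire P a y"
    using a(3) step.prems by simp
  have "internal_action P a \<or> (\<exists>N. negotiation P N \<and> a \<in> N)"
    using assms(2) a(1) by (simp add: internal_or_negotiation_def)
  then have "\<exists>y'. y' \<subseteq># y \<and> size y' = size q' \<and> (step P)\<^sup>*\<^sup>* y' q'"
    using internal_step_restrict[OF assms(1) _ a(2) q']
      negotiation_step_restrict[OF assms(1) _ _ a(2) q'] by blast
  then obtain y' where y': "y' \<subseteq># y" "size y' = size q'" "(step P)\<^sup>*\<^sup>* y' q'"
    by blast
  from step.IH[OF y'(1)] y'(2,3) show ?case
    by (metis rtranclp_trans)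
qed

lemma sat_phi_cutoff:
  assumes "gsp_process P" and "internal_or_negotiation P" and "sat_phi P n m s"
  shows "sat_phi P m m s"
proof -
  obtain q where q: "(step P)\<^sup>*\<^sup>* (replicate_mset n (start P)) q" and "m \<le> count q s"
    using assms(3) by (auto simp: sat_phi_def reachable_def)
  then have "replicate_mset m s \<subseteq># q"
    by (simp add: count_le_replicate_mset_subset_eq)
  from steps_restrict[OF assms(1,2) q this]
  obtain p where p: "p \<subseteq># replicate_mset n (start P)" "size p = m"
    and steps: "(step P)\<^sup>*\<^sup>* p (replicate_mset m s)"
    by auto
  \<comment> \<open>A selection from copies of \<open>start P\<close> is determined by its size, so
    \<open>p\<close> is the initial global state of the system with \<open>m\<close>
    processes.\<close>
  then have "p = replicate_mset m (start P)"
    by (auto elim: msubseteq_replicate_msetE)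
  then show ?thesis
    using steps unfolding sat_phi_def reachable_def
    by (intro exI[of _ "replicate_mset m s"]) simp
qed

theorem lemma1:
  fixes P :: "('s, 'a) process"
  assumes "gsp_process P"
    and "well_behaved P"
    and "internal_or_negotiation P"
  shows "\<forall>s\<in>states P. synchronization_independent P s"
  unfolding synchronization_independent_def cutoff_def
  \<comment> \<open>The converse implication takes \<open>m\<close> itself as the number of
    processes.\<close>
  using sat_phi_cutoff[OF assms(1,3)] by blast

end
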